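(* Let $q\ge 2$ be an integer. The spectral measure of any branching-type stationary stochastic process on the rooted $q$-homogeneous tree $T_q$ is absolutely continuous with respect to the Lebesgue measure on $\mathbb{T}$, and the corresponding Radon-Nikodym derivative is real-analytic (that is, has a real-analytic version).
   Context: $\mathbb{N}=\{0,1,2,\dots\}$, $\mathbb{T}=\mathbb{R}/2\pi\mathbb{Z}$. $T_q$ is (the vertex set of) the infinite rooted tree in which every vertex, including the root $e$, has exactly $q$ children. For a rooted tree $T$, a rooted geodesic ray is an infinite geodesic $\xi=(\sigma_n)_{n\in\mathbb{N}}$ with $\sigma_0=e$; the set of these is $\partial T$, and each $\xi$ is identified with $\mathbb{N}$ via $\sigma_n\leftrightarrow n$. Two vertices are comparable if they lie on a common rooted geodesic ray. Random variables are complex-valued and, for mean-zero variables, $\mathrm{Cov}(X,Y)=\mathbb{E}(X\overline{Y})$. A mean-zero square-integrable process $(X_n)_{n\in\mathbb{N}}$ is (weakly) stationary if $\mathrm{Cov}(X_n,X_{n+k})$ does not depend on $n$, for all $n,k\in\mathbb{N}$; its spectral measure is the unique positive Radon measure $\nu$ on $\mathbb{T}$ with $\mathrm{Cov}(X_n,X_{n+k})=\int_{\mathbb{T}}e^{-ik\theta}d\nu(\theta)$ for all $n,k\in\mathbb{N}$. A mean-zero square-integrable process $(X_\sigma)_{\sigma\in T}$ is a branching-type stationary stochastic process on $T$ if: (i) for every $\xi\in\partial T$, the restriction $(X_\sigma)_{\sigma\in\xi}$ is stationary; (ii) all these restrictions have the same spectral measure, which is called the spectral measure of the process; (iii) $\mathrm{Cov}(X_\sigma,X_\tau)=0$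 for all non-comparable $\sigma,\tau\in T$. *)

theory Defs
  imports "HOL-Probability.Probability"
begin

section \<open>The circle\<close>

quotient_type circle = real / "\<lambda>x y. \<exists>k::int. x - y = 2 * pi * of_int k"
  morphisms rep_circle to_circle
proof (rule equivpI)
  show "reflp (\<lambda>x y. \<exists>k::int. x - y = 2 * pi * of_int k)"
    by (rule reflpI) (rule exI[of _ 0], simp)
  show "symp (\<lambda>x y. \<exists>k::int. x - y = 2 * pi * of_int k)"
  proof (rule sympI)
    fix x y :: real
    assume "\<exists>k::int. x - y = 2 * pi * of_int k"
    then obtain k :: int where "x - y = 2 * pi * of_int k" ..
    then have "y - x = 2 * pi * of_int (- k)" by (simp add: algebra_simps)
    then show "\<exists>k::int. y - x = 2 * pi * of_int k" ..
  qed
  show "transp (\<lambda>x y. \<exists>k::int. x - y = 2 * pi * of_int k)"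
  proof (rule transpI)
    fix x y z :: real
    assume "\<exists>k::int. x - y = 2 * pi * of_int k" "\<exists>k::int. y - z = 2 * pi * of_int k"
    then obtain k l :: int
      where "x - y = 2 * pi * of_int k" "y - z = 2 * pi * of_int l" by blast
    then have "x - z = 2 * pi * of_int (k + l)" by (simp add: algebra_simps)
    then show "\<exists>k::int. x - z = 2 * pi * of_int k" ..
  qed
qed

instantiation circle :: topological_space
begin

definition open_circle :: "circle set \<Rightarrow> bool" where
  "open_circle U \<longleftrightarrow> open (to_circle -` U)"

instance
  by standard (auto simp: open_circle_def vimage_Union)

end

lift_definition circle_cis :: "circle \<Rightarrow> complex" is cis
proof -
  fix x y :: real
  assume "\<exists>k::int. x - y = 2 * pi * of_int k"
  then obtain k :: int where "x - y = 2 * pi * of_int k" ..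
  then have "x = y + 2 * pi * of_int k" by linarith
  then have "sin x = sin y \<and> cos x = cos y" using sin_cos_eq_iff[of x y] by blast
  then show "cis x = cis y" by (simp add: complex_eq_iff)
qed

lemma inj_circle_cis: "inj circle_cis"
proof (rule injI)
  fix x y :: circle
  assume "circle_cis x = circle_cis y"
  then show "x = y"
  proof transfer
    fix x y :: real
    assume "cis x = cis y"
    then have "sin x = sin y \<and> cos x = cos y" by (simp add: complex_eq_iff)
    then have "\<exists>k::int. x = y + 2 * pi * of_int k" by (simp only: sin_cos_eq_iff)
    then show "\<exists>k::int. x - y = 2 * pi * of_int k" by (simp add: diff_eq_eq add.commute)
  qed
qed

lemma open_vimage_circle_cis:
  assumes "open U"
  shows "open (circle_cis -` U)"
proof -
  have "to_circle -` circle_cis -` U = cis -` U"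
    by (auto simp: circle_cis.abs_eq)
  moreover have "continuous_on UNIV cis"
    by (intro continuous_on_cis continuous_on_id)
  then have "open (cis -` U)" by (rule open_vimage[OF assms])
  ultimately show ?thesis by (simp only: open_circle_def)
qed

instance circle :: t2_space
proof
  fix x y :: circle
  assume "x \<noteq> y"
  then have "circle_cis x \<noteq> circle_cis y" by (simp add: inj_eq[OF inj_circle_cis])
  then obtain U V where "open U" "open V" "circle_cis x \<in> U" "circle_cis y \<in> V" "U \<inter> V = {}"
    by (metis hausdorff)
  then show "\<exists>U V. open U \<and> open V \<and> x \<in> U \<and> y \<in> V \<and> U \<inter> V = {}"
    by (intro exI[of _ "circle_cis -` U"] exI[of _ "circle_cis -` V"] conjI)
      (simp_all add: open_vimage_circle_cis vimage_Int[symmetric])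
qed

text \<open>
  Lebesgue measure, not normalised (total mass \<open>2 * pi\<close>), as the image of Lebesgue measure on a
  fundamental domain.
\<close>

definition circle_lebesgue :: "circle measure" where
  "circle_lebesgue = distr (restrict_space lborel {0..<2 * pi}) borel to_circle"

definition radon_measure :: "'a::t2_space measure \<Rightarrow> bool" where
  "radon_measure \<nu> \<longleftrightarrow>
     sets \<nu> = sets borel \<and>
     (\<forall>x. \<exists>U. open U \<and> x \<in> U \<and> emeasure \<nu> U < \<infinity>) \<and>
     (\<forall>A\<in>sets borel. emeasure \<nu> A = (SUP K\<in>{K. compact K \<and> K \<subseteq> A}. emeasure \<nu> K))"

definition real_analytic_at :: "(real \<Rightarrow> real) \<Rightarrow> real \<Rightarrow> bool" where
  "real_analytic_at f x \<longleftrightarrow>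
     (\<exists>r>0. \<exists>a :: nat \<Rightarrow> real. \<forall>y. \<bar>y - x\<bar> < r \<longrightarrow> (\<lambda>n. a n * (y - x) ^ n) sums f y)"

text \<open>The projection from the line is a local chart, so analyticity is that of the lift.\<close>

definition real_analytic_on_circle :: "(circle \<Rightarrow> real) \<Rightarrow> bool" where
  "real_analytic_on_circle f \<longleftrightarrow> (\<forall>x. real_analytic_at (f \<circ> to_circle) x)"

section \<open>The rooted homogeneous tree\<close>

text \<open>
  Vertices are the words over \<open>{..<q}\<close>; the root is the empty word, and the children of a word
  are its extensions by one letter.
\<close>

definition tree_vertices :: "nat \<Rightarrow> nat list set" where
  "tree_vertices q = lists {..<q}"

definition tree_adj :: "nat \<Rightarrow> nat list \<Rightarrow> nat list \<Rightarrow> bool" where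
  "tree_adj q \<sigma> \<tau> \<longleftrightarrow>
     \<sigma> \<in> tree_vertices q \<and> \<tau> \<in> tree_vertices q \<and> (\<exists>i. \<tau> = \<sigma> @ [i] \<or> \<sigma> = \<tau> @ [i])"

text \<open>Graph distance: the least length of a walk.\<close>

definition tree_dist :: "nat \<Rightarrow> nat list \<Rightarrow> nat list \<Rightarrow> nat" where
  "tree_dist q \<sigma> \<tau> = (LEAST n. (tree_adj q ^^ n) \<sigma> \<tau>)"

definition rooted_rays :: "nat \<Rightarrow> (nat \<Rightarrow> nat list) set" where
  "rooted_rays q =
     {\<xi>. \<xi> 0 = [] \<and> (\<forall>n. \<xi> n \<in> tree_vertices q) \<and>
         (\<forall>m n. m \<le> n \<longrightarrow> tree_dist q (\<xi> m) (\<xi> n) = n - m)}"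

definition comparable :: "nat \<Rightarrow> nat list \<Rightarrow> nat list \<Rightarrow> bool" where
  "comparable q \<sigma> \<tau> \<longleftrightarrow> (\<exists>\<xi>\<in>rooted_rays q. \<sigma> \<in> range \<xi> \<and> \<tau> \<in> range \<xi>)"

section \<open>Stationary processes\<close>

definition mean_zero_sq_integrable :: "'w measure \<Rightarrow> ('w \<Rightarrow> complex) \<Rightarrow> bool" where
  "mean_zero_sq_integrable M Y \<longleftrightarrow>
     Y \<in> borel_measurable M \<and> integrable M (\<lambda>\<omega>. (cmod (Y \<omega>))\<^sup>2) \<and> (LINT \<omega>|M. Y \<omega>) = 0"

definition cov :: "'w measure \<Rightarrow> ('w \<Rightarrow> complex) \<Rightarrow> ('w \<Rightarrow> complex) \<Rightarrow> complex" where
  "cov M Y Z = (LINT \<omega>|M. Y \<omega> * cnj (Z \<omega>))"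

definition stationary_process :: "'w measure \<Rightarrow> (nat \<Rightarrow> 'w \<Rightarrow> complex) \<Rightarrow> bool" where
  "stationary_process M Y \<longleftrightarrow>
     (\<forall>n. mean_zero_sq_integrable M (Y n)) \<and>
     (\<forall>k n m. cov M (Y n) (Y (n + k)) = cov M (Y m) (Y (m + k)))"

text \<open>
  The spectral measure is treated as a relation; Herglotz's theorem gives exactly one spectral
  measure for every stationary process. The integrand is \<open>exp (- \<i> k \<theta>)\<close>.
\<close>

definition is_spectral_measure ::
    "'w measure \<Rightarrow> (nat \<Rightarrow> 'w \<Rightarrow> complex) \<Rightarrow> circle measure \<Rightarrow> bool" where
  "is_spectral_measure M Y \<nu> \<longleftrightarrow>
     radon_measure \<nu> \<and>
     (\<forall>n k. cov M (Y n) (Y (n + k)) = (LINT \<theta>|\<nu>. cnj (circle_cis \<theta>) ^ k))"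

text \<open>
  A process on the tree is given as a family indexed by all words; only its values on the
  vertices matter.
\<close>

definition is_tree_spectral_measure ::
    "'w measure \<Rightarrow> nat \<Rightarrow> (nat list \<Rightarrow> 'w \<Rightarrow> complex) \<Rightarrow> circle measure \<Rightarrow> bool" where
  "is_tree_spectral_measure M q X \<nu> \<longleftrightarrow>
     (\<forall>\<xi>\<in>rooted_rays q. is_spectral_measure M (\<lambda>n. X (\<xi> n)) \<nu>)"

definition branching_type_stationary ::
    "'w measure \<Rightarrow> nat \<Rightarrow> (nat list \<Rightarrow> 'w \<Rightarrow> complex) \<Rightarrow> bool" where
  "branching_type_stationary M q X \<longleftrightarrow>
     (\<forall>\<sigma>\<in>tree_vertices q. mean_zero_sq_integrable M (X \<sigma>)) \<and>
     (\<forall>\<xi>\<in>rooted_rays q. stationary_process M (\<lambda>n. X (\<xi> n))) \<and>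
     (\<exists>\<nu>. is_tree_spectral_measure M q X \<nu>) \<and>
     (\<forall>\<sigma>\<in>tree_vertices q. \<forall>\<tau>\<in>tree_vertices q.
        \<not> comparable q \<sigma> \<tau> \<longrightarrow> cov M (X \<sigma>) (X \<tau>) = 0)"

end

theory Submission
  imports Defs "HOL-Complex_Analysis.Complex_Analysis"
begin

text \<open>
  Write \<open>c k\<close> for the Fourier coefficient of the spectral measure \<open>\<nu>\<close> at \<open>k\<close>, which is the
  covariance of \<open>X \<sigma>\<close> and \<open>X \<tau>\<close> whenever \<open>\<tau>\<close> lies \<open>k\<close> generations below \<open>\<sigma>\<close> on a ray. The
  branching forces these coefficients to decay exponentially. The \<open>q ^ k\<close> variables at generation
  \<open>k\<close> are pairwise uncorrelated, as two distinct vertices at equal depth never lie on one ray,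
  and each has variance \<open>c 0\<close>; so their sum has variance \<open>q ^ k * c 0\<close>. Each of them has
  covariance \<open>c k\<close> with the root variable, so the covariance of the root with the sum is
  \<open>q ^ k * c k\<close>. Cauchy-Schwarz gives \<open>q ^ k * \<bar>c k\<bar> \<le> c 0 * sqrt (q ^ k)\<close>, that is
  \<open>\<bar>c k\<bar> \<le> c 0 / sqrt q ^ k\<close> (lemma \<open>cov_decay\<close>).

  Since \<open>q \<ge> 2\<close>, the power series \<open>F z = (\<Sum>k. c k * z ^ k)\<close> is holomorphic on a disc of radius
  larger than 1, and \<open>(2 * Re (F z) - c 0) / (2 * pi)\<close> is a real-analytic function on the unit
  circle. It is the full Fourier series of \<open>\<nu>\<close>, because the coefficients at negative indices are
  the conjugates of those at positive ones. Hence it has the same Fourier coefficients as \<open>\<nu>\<close>.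
  It is nonnegative because inside the disc it is the integral against \<open>\<nu>\<close> of the Poisson
  kernel, which is positive. A finite measure on the circle is determined by its
  Fourier coefficients (lemma \<open>circle_measure_eqI\<close>, by Stone-Weierstrass), so this function is a
  density of \<open>\<nu>\<close> with respect to Lebesgue measure (lemma \<open>density_dens\<close>).
\<close>

section \<open>Second moments and complex conjugation\<close>

lemma borel_measurable_cnj [measurable]: "cnj \<in> borel \<rightarrow>\<^sub>M borel"
  by (intro borel_measurable_continuous_onI continuous_intros)

lemma sq_integrable_mult_cnj:
  fixes Y Z :: "'w \<Rightarrow> complex"
  assumes [measurable]: "Y \<in> borel_measurable M" "Z \<in> borel_measurable M"
    and Y: "integrable M (\<lambda>\<omega>. (cmod (Y \<omega>))\<^sup>2)" and Z: "integrable M (\<lambda>\<omega>. (cmod (Z \<omega>))\<^sup>2)"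
  shows "integrable M (\<lambda>\<omega>. Y \<omega> * cnj (Z \<omega>))"
proof (rule Bochner_Integration.integrable_bound)
  show "integrable M (\<lambda>\<omega>. (cmod (Y \<omega>))\<^sup>2 + (cmod (Z \<omega>))\<^sup>2)" using Y Z by simp
  have "cmod (Y \<omega>) * cmod (Z \<omega>) \<le> (cmod (Y \<omega>))\<^sup>2 + (cmod (Z \<omega>))\<^sup>2" for \<omega>
    using sum_squares_bound[of "cmod (Y \<omega>)" "cmod (Z \<omega>)"]
      mult_nonneg_nonneg[OF norm_ge_zero[of "Y \<omega>"] norm_ge_zero[of "Z \<omega>"]] by linarith
  then show "AE \<omega> in M. norm (Y \<omega> * cnj (Z \<omega>)) \<le> norm ((cmod (Y \<omega>))\<^sup>2 + (cmod (Z \<omega>))\<^sup>2)"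
    by (simp add: norm_mult)
qed measurable

lemma cov_self: "cov M Y Y = of_real (LINT \<omega>|M. (cmod (Y \<omega>))\<^sup>2)"
  unfolding cov_def by (simp add: complex_norm_square[symmetric] flip: integral_complex_of_real)

text \<open>
  Cauchy-Schwarz in the form of a weighted inequality of arithmetic and geometric means, which
  avoids a case distinction on degenerate variables; the weight is chosen where it is applied.
\<close>

lemma norm_cov_le:
  assumes [measurable]: "Y \<in> borel_measurable M" "Z \<in> borel_measurable M"
    and Y: "integrable M (\<lambda>\<omega>. (cmod (Y \<omega>))\<^sup>2)" and Z: "integrable M (\<lambda>\<omega>. (cmod (Z \<omega>))\<^sup>2)"
    and a: "0 < a"
  shows "cmod (cov M Y Z) \<le> (a * Re (cov M Y Y) + Re (cov M Z Z) / a) / 2"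
proof -
  have pt: "cmod (Y \<omega> * cnj (Z \<omega>)) \<le> (a * (cmod (Y \<omega>))\<^sup>2 + (cmod (Z \<omega>))\<^sup>2 / a) / 2" for \<omega>
  proof -
    have "0 \<le> (a * cmod (Y \<omega>) - cmod (Z \<omega>))\<^sup>2 / (2 * a)" using a by simp
    also have "\<dots> = (a * (cmod (Y \<omega>))\<^sup>2 + (cmod (Z \<omega>))\<^sup>2 / a) / 2 - cmod (Y \<omega>) * cmod (Z \<omega>)"
      using a by (simp add: field_simps power2_eq_square)
    finally show ?thesis by (simp add: norm_mult)
  qed
  have "cmod (cov M Y Z) \<le> (LINT \<omega>|M. cmod (Y \<omega> * cnj (Z \<omega>)))"
    unfolding cov_def by (rule integral_norm_bound)
  also have "\<dots> \<le> (LINT \<omega>|M. (a * (cmod (Y \<omega>))\<^sup>2 + (cmod (Z \<omega>))\<^sup>2 / a) / 2)"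
    using Y Z pt sq_integrable_mult_cnj[OF assms(1-4)]
    by (intro integral_mono integrable_norm) auto
  also have "\<dots> = (a * Re (cov M Y Y) + Re (cov M Z Z) / a) / 2"
    using Y Z by (simp add: cov_self)
  finally show ?thesis .
qed

section \<open>Rays and levels of the tree\<close>

lemma tree_adj_length:
  "tree_adj q \<sigma> \<tau> \<Longrightarrow> length \<tau> \<le> Suc (length \<sigma>)"
  by (auto simp: tree_adj_def)

lemma walk_length: "(tree_adj q ^^ n) \<sigma> \<tau> \<Longrightarrow> length \<tau> \<le> length \<sigma> + n"
proof (induction n arbitrary: \<tau>)
  case (Suc n)
  then obtain \<rho> where "(tree_adj q ^^ n) \<sigma> \<rho>" "tree_adj q \<rho> \<tau>" by auto
  with Suc.IH[of \<rho>] tree_adj_length[of q \<rho> \<tau>] show ?case by simp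
qed simp

lemma walk_append:
  "\<sigma> @ \<tau> \<in> tree_vertices q \<Longrightarrow> (tree_adj q ^^ length \<tau>) \<sigma> (\<sigma> @ \<tau>)"
proof (induction \<tau> rule: rev_induct)
  case (snoc x \<tau>)
  then have "(tree_adj q ^^ length \<tau>) \<sigma> (\<sigma> @ \<tau>)"
    by (simp add: tree_vertices_def)
  moreover have "tree_adj q (\<sigma> @ \<tau>) (\<sigma> @ \<tau> @ [x])"
    using snoc.prems by (auto simp: tree_adj_def tree_vertices_def)
  ultimately show ?case by auto
qed simp

text \<open>
  A step of a walk lengthens a word by at most one letter, so spelling out the suffix letter by
  letter is a shortest walk.
\<close>

lemma tree_dist_append:
  assumes "\<sigma> @ \<tau> \<in> tree_vertices q"
  shows "tree_dist q \<sigma> (\<sigma> @ \<tau>) = length \<tau>"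
  unfolding tree_dist_def
proof (rule Least_equality)
  show "(tree_adj q ^^ length \<tau>) \<sigma> (\<sigma> @ \<tau>)" by (rule walk_append[OF assms])
  show "length \<tau> \<le> n" if "(tree_adj q ^^ n) \<sigma> (\<sigma> @ \<tau>)" for n
    using walk_length[OF that] by simp
qed

lemma length_rooted_ray:
  assumes "\<xi> \<in> rooted_rays q"
  shows "length (\<xi> n) = n"
proof -
  have "tree_dist q (\<xi> 0) (\<xi> n) = n - 0" "\<xi> 0 = []" "\<xi> n \<in> tree_vertices q"
    using assms unfolding rooted_rays_def by blast+
  with tree_dist_append[of "[]" "\<xi> n" q] show ?thesis by simp
qed

text \<open>The ray continues below \<open>\<sigma>\<close> by always taking the child with label 0.\<close>

lemma rooted_ray_through_vertex:
  assumes "\<sigma> \<in> tree_vertices q" "0 < q"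
  shows "\<exists>\<xi>\<in>rooted_rays q. \<xi> 0 = [] \<and> \<xi> (length \<sigma>) = \<sigma>"
proof -
  define w where "w = (\<lambda>n. \<sigma> @ replicate n (0::nat))"
  define \<xi> where "\<xi> = (\<lambda>n. take n (w n))"
  have verts: "w n \<in> tree_vertices q" for n
    using assms by (auto simp: w_def tree_vertices_def)
  have vert: "\<xi> n \<in> tree_vertices q" for n
    using verts[of n] unfolding \<xi>_def tree_vertices_def by (auto dest: in_set_takeD)
  have "tree_dist q (\<xi> m) (\<xi> n) = n - m" if "m \<le> n" for m n
  proof -
    have "take m (w m) = take m (w n)"
      using that by (auto simp: w_def take_append min_def)
    then have "\<xi> n = \<xi> m @ drop m (\<xi> n)"
      using that by (metis \<xi>_def append_take_drop_id min.absorb1 take_take)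
    moreover have "length (drop m (\<xi> n)) = n - m" by (simp add: \<xi>_def w_def)
    ultimately show ?thesis using tree_dist_append[of "\<xi> m" "drop m (\<xi> n)" q] vert[of n] by simp
  qed
  then have "\<xi> \<in> rooted_rays q" using vert by (simp add: rooted_rays_def \<xi>_def)
  moreover have "\<xi> 0 = []" "\<xi> (length \<sigma>) = \<sigma>" by (simp_all add: \<xi>_def w_def)
  ultimately show ?thesis by blast
qed

text \<open>A ray has exactly one vertex at each depth.\<close>

lemma not_comparable_same_level:
  "length \<sigma> = length \<tau> \<Longrightarrow> \<sigma> \<noteq> \<tau> \<Longrightarrow> \<not> comparable q \<sigma> \<tau>"
  by (auto simp: comparable_def length_rooted_ray)

definition level :: "nat \<Rightarrow> nat \<Rightarrow> nat list set" where
  "level q k = {\<sigma> \<in> tree_vertices q. length \<sigma> = k}"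

lemma level_eq: "level q k = {xs. set xs \<subseteq> {..<q} \<and> length xs = k}"
  by (auto simp: level_def tree_vertices_def)

lemma finite_level: "finite (level q k)"
  by (simp add: level_eq finite_lists_length_eq)

lemma card_level: "card (level q k) = q ^ k"
  by (simp add: level_eq card_lists_length_eq)

section \<open>Exponential decay of the covariances\<close>

text \<open>
  The sum \<open>S\<close> over a level consists of \<open>q ^ k\<close> orthogonal terms, so its norm grows only like
  \<open>sqrt q ^ k\<close>, while its covariance with the root adds up \<open>q ^ k\<close> equal terms.
\<close>

lemma cov_decay:
  fixes M :: "'w measure"
  assumes q: "0 < q" and X: "branching_type_stationary M q X"
    and nu: "is_tree_spectral_measure M q X \<nu>"
  shows "cmod (LINT \<theta>|\<nu>. cnj (circle_cis \<theta>) ^ k) \<le> measure \<nu> (space \<nu>) / sqrt q ^ k"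
proof -
  define c where "c = (\<lambda>k. LINT \<theta>|\<nu>. cnj (circle_cis \<theta>) ^ k)"
  have ray_cov: "cov M (X (\<xi> n)) (X (\<xi> (n + k))) = c k" if "\<xi> \<in> rooted_rays q" for \<xi> n k
    using nu that by (simp add: is_tree_spectral_measure_def is_spectral_measure_def c_def)
  have sq: "X \<sigma> \<in> borel_measurable M" "integrable M (\<lambda>\<omega>. (cmod (X \<sigma> \<omega>))\<^sup>2)"
    if "\<sigma> \<in> tree_vertices q" for \<sigma>
    using X that by (auto simp: branching_type_stationary_def mean_zero_sq_integrable_def)
  have root: "[] \<in> tree_vertices q" by (simp add: tree_vertices_def)
  have prod: "integrable M (\<lambda>\<omega>. X \<sigma> \<omega> * cnj (X \<tau> \<omega>))"
    if "\<sigma> \<in> tree_vertices q" "\<tau> \<in> tree_vertices q" for \<sigma> \<tau>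
    using that by (intro sq_integrable_mult_cnj sq)
  have cov_root: "cov M (X []) (X \<sigma>) = c k" and cov_diag: "cov M (X \<sigma>) (X \<sigma>) = c 0"
    if \<sigma>: "\<sigma> \<in> level q k" for \<sigma> k
  proof -
    from \<sigma> have "\<sigma> \<in> tree_vertices q" "length \<sigma> = k" by (auto simp: level_def)
    with q obtain \<xi> where "\<xi> \<in> rooted_rays q" "\<xi> 0 = []" "\<xi> k = \<sigma>"
      using rooted_ray_through_vertex by metis
    then show "cov M (X []) (X \<sigma>) = c k" "cov M (X \<sigma>) (X \<sigma>) = c 0"
      using ray_cov[of \<xi> 0 k] ray_cov[of \<xi> k 0] by auto
  qed
  define S where "S = (\<lambda>\<omega>. \<Sum>\<sigma>\<in>level q k. X \<sigma> \<omega>)"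
  have lev: "\<sigma> \<in> tree_vertices q" if "\<sigma> \<in> level q k" for \<sigma> using that by (simp add: level_def)
  have Smeas: "S \<in> borel_measurable M"
    unfolding S_def using sq lev by (intro borel_measurable_sum) auto
  have SS: "(\<lambda>\<omega>. S \<omega> * cnj (S \<omega>)) = (\<lambda>\<omega>. \<Sum>\<sigma>\<in>level q k. \<Sum>\<tau>\<in>level q k. X \<sigma> \<omega> * cnj (X \<tau> \<omega>))"
    by (simp add: S_def sum_product)
  have Sint: "integrable M (\<lambda>\<omega>. S \<omega> * cnj (S \<omega>))"
    unfolding SS using prod lev by (intro Bochner_Integration.integrable_sum) auto
  then have "integrable M (\<lambda>\<omega>. Re (S \<omega> * cnj (S \<omega>)))" by (rule integrable_Re)
  then have Ssq: "integrable M (\<lambda>\<omega>. (cmod (S \<omega>))\<^sup>2)"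
    by (simp add: complex_norm_square[symmetric] del: complex_mult_cnj)
  have cov_off_diag: "cov M (X \<sigma>) (X \<tau>) = 0"
    if "\<sigma> \<in> level q k" "\<tau> \<in> level q k" "\<sigma> \<noteq> \<tau>" for \<sigma> \<tau>
  proof -
    from that have "\<not> comparable q \<sigma> \<tau>" by (intro not_comparable_same_level) (auto simp: level_def)
    with X that lev show ?thesis unfolding branching_type_stationary_def by blast
  qed
  have "cov M S S = (\<Sum>\<sigma>\<in>level q k. \<Sum>\<tau>\<in>level q k. cov M (X \<sigma>) (X \<tau>))"
    unfolding cov_def SS using prod lev by (simp add: Bochner_Integration.integral_sum)
  also have "\<dots> = (\<Sum>\<sigma>\<in>level q k. \<Sum>\<tau>\<in>level q k. if \<sigma> = \<tau> then c 0 else 0)"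
    by (intro sum.cong refl) (simp add: cov_diag cov_off_diag)
  also have "\<dots> = of_nat (q ^ k) * c 0" by (simp add: finite_level card_level)
  finally have cov_S: "cov M S S = of_nat (q ^ k) * c 0" .
  have "cov M (X []) S = (\<Sum>\<sigma>\<in>level q k. cov M (X []) (X \<sigma>))"
    unfolding cov_def S_def using prod root lev
    by (simp add: sum_distrib_left Bochner_Integration.integral_sum)
  also have "\<dots> = of_nat (q ^ k) * c k" by (simp add: cov_root card_level)
  finally have cov_root_S: "cov M (X []) S = of_nat (q ^ k) * c k" .
  have cov_00: "cov M (X []) (X []) = c 0" using cov_diag[of "[]" 0] by (simp add: level_def root)
  \<comment> \<open>The weight \<open>s\<close> balances the two terms of the inequality: \<open>S\<close> has variance \<open>s\<^sup>2 * c 0\<close>.\<close>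
  define s where "s = sqrt q ^ k"
  have s: "0 < s" "real q ^ k = s * s"
    using q by (simp_all add: s_def flip: power_mult_distrib)
  have "s * s * cmod (c k) \<le> (s * Re (c 0) + s * s * Re (c 0) / s) / 2"
    using norm_cov_le[OF sq(1)[OF root] Smeas sq(2)[OF root] Ssq s(1)] s
    by (simp add: cov_root_S cov_S cov_00 norm_mult norm_power)
  then have "s * (s * cmod (c k)) \<le> s * Re (c 0)" using s by (simp add: mult.assoc)
  then have "s * cmod (c k) \<le> Re (c 0)" using s(1) by simp
  moreover have "Re (c 0) = measure \<nu> (space \<nu>)" by (simp add: c_def)
  ultimately have "cmod (c k) \<le> measure \<nu> (space \<nu>) / s"
    using s(1) by (simp add: field_simps)
  then show ?thesis by (simp add: c_def s_def)
qed

section \<open>Finite measures on the circle\<close>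

lemma continuous_to_circle: "continuous_on UNIV to_circle"
  by (simp add: continuous_on_open_vimage open_circle_def)

lemma continuous_circle_cis: "continuous_on UNIV circle_cis"
  by (simp add: continuous_on_open_vimage open_vimage_circle_cis)

lemma measurable_to_circle [measurable]: "to_circle \<in> borel \<rightarrow>\<^sub>M borel"
  by (rule borel_measurable_continuous_onI[OF continuous_to_circle])

lemma measurable_circle_cis [measurable]: "circle_cis \<in> borel \<rightarrow>\<^sub>M borel"
  by (rule borel_measurable_continuous_onI[OF continuous_circle_cis])

lemma circle_cis_to_circle [simp]: "circle_cis (to_circle x) = cis x"
  by (rule circle_cis.abs_eq)

lemma norm_circle_cis [simp]: "cmod (circle_cis \<theta>) = 1"
  by transfer simp

text \<open>
  A left inverse of the embedding into the complex plane that is Borel measurable, although not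
  continuous. It carries uniqueness of measures on the plane over to the circle.
\<close>

lemma to_circle_Im_Ln [simp]: "to_circle (Im (Ln (circle_cis \<theta>))) = \<theta>"
proof -
  have nz: "circle_cis \<theta> \<noteq> 0" using norm_circle_cis[of \<theta>] by force
  have "circle_cis (to_circle (Im (Ln (circle_cis \<theta>)))) = exp (Ln (circle_cis \<theta>))"
    using nz by (simp add: exp_eq_polar)
  also have "\<dots> = circle_cis \<theta>" using nz by simp
  finally show ?thesis by (rule injD[OF inj_circle_cis])
qed

lemma compact_circle: "compact (UNIV :: circle set)"
proof -
  have "to_circle x \<in> to_circle ` {-pi..pi}" for x
  proof -
    have "circle_cis (to_circle x) \<noteq> 0" using norm_circle_cis[of "to_circle x"] by force
    then have "Im (Ln (circle_cis (to_circle x))) \<in> {-pi..pi}"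
      using mpi_less_Im_Ln[of "circle_cis (to_circle x)"] Im_Ln_le_pi[of "circle_cis (to_circle x)"]
      by auto
    then show ?thesis by (metis imageI to_circle_Im_Ln)
  qed
  then have "(UNIV :: circle set) \<subseteq> to_circle ` {-pi..pi}"
    by (metis subsetI to_circle_Im_Ln)
  moreover have "compact (to_circle ` {-pi..pi})"
    by (rule compact_continuous_image[OF continuous_on_subset[OF continuous_to_circle]]) auto
  ultimately show ?thesis by (simp add: top.extremum_unique)
qed

text \<open>Local finiteness is finiteness on a compact space.\<close>

lemma finite_radon_measure_circle:
  fixes \<nu> :: "circle measure"
  assumes "radon_measure \<nu>"
  shows "finite_measure \<nu>"
proof -
  have sets: "sets \<nu> = sets borel" using assms by (simp add: radon_measure_def)
  then have sp: "space \<nu> = UNIV" using sets_eq_imp_space_eq[of \<nu> borel] by simp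
  define \<C> where "\<C> = {U. open U \<and> emeasure \<nu> U < \<infinity>}"
  have "\<forall>x. \<exists>U. open U \<and> x \<in> U \<and> emeasure \<nu> U < \<infinity>"
    using assms unfolding radon_measure_def by blast
  then have "UNIV \<subseteq> \<Union>\<C>" unfolding \<C>_def by blast
  then obtain \<D> where \<D>: "\<D> \<subseteq> \<C>" "finite \<D>" "UNIV \<subseteq> \<Union>\<D>"
    by (rule compactE[OF compact_circle]) (auto simp: \<C>_def)
  have "emeasure \<nu> (\<Union>U\<in>\<D>. U) \<le> (\<Sum>U\<in>\<D>. emeasure \<nu> U)"
    using \<D> by (intro emeasure_subadditive_finite) (auto simp: sets \<C>_def)
  also have "\<dots> < \<infinity>" using \<D> by (auto simp: \<C>_def)
  finally have "emeasure \<nu> UNIV < \<infinity>" using \<D>(3) by (simp add: top.extremum_unique)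
  then show ?thesis by (intro finite_measureI) (simp add: sp)
qed

lemma finite_circle_lebesgue: "finite_measure circle_lebesgue"
proof -
  have "finite_measure (restrict_space lborel {0..<2 * pi})"
    by (rule finite_measureI) (simp add: emeasure_restrict_space space_restrict_space)
  then show ?thesis unfolding circle_lebesgue_def
    by (intro finite_measure.finite_measure_distr measurable_restrict_space1) auto
qed

lemma sets_circle_lebesgue [measurable_cong, simp]: "sets circle_lebesgue = sets borel"
  by (simp add: circle_lebesgue_def)

text \<open>
  The indicator of a closed set is a pointwise limit of continuous cut-offs of the distance to
  it, so the integrals determine the measure on the intersection-stable generator of closed sets.
\<close>

lemma finite_borel_measure_eqI:
  fixes M N :: "'a::metric_space measure"
  assumes fin: "finite_measure M" "finite_measure N"
    and [measurable_cong]: "sets M = sets borel" "sets N = sets borel"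
    and eq: "\<And>f :: 'a \<Rightarrow> real. continuous_on UNIV f \<Longrightarrow> range f \<subseteq> {0..1} \<Longrightarrow>
               integral\<^sup>L M f = integral\<^sup>L N f"
  shows "M = N"
proof -
  have closed_eq: "measure M A = measure N A" if A: "closed A" for A
  proof (cases "A = {}")
    case False
    define f where "f = (\<lambda>n x. max 0 (1 - real n * infdist x A))"
    have cont: "continuous_on UNIV (f n)" for n
      unfolding f_def by (intro continuous_intros continuous_on_infdist)
    have rng: "range (f n) \<subseteq> {0..1}" for n by (auto simp: f_def infdist_nonneg)
    have abs_f: "\<bar>f n x\<bar> \<le> 1" for n x by (simp add: f_def infdist_nonneg)
    have lim: "(\<lambda>n. f n x) \<longlonglongrightarrow> indicator A x" for x
    proof (cases "x \<in> A")
      case True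
      then show ?thesis by (simp add: f_def)
    next
      case out: False
      then have d: "infdist x A > 0" using A False infdist_pos_not_in_closed by blast
      obtain n0 where "real n0 > 1 / infdist x A" using reals_Archimedean2 by blast
      then have "f n x = 0" if "n \<ge> n0" for n
      proof -
        have "1 < real n0 * infdist x A" using \<open>real n0 > 1 / infdist x A\<close> d
          by (simp add: field_simps)
        also have "\<dots> \<le> real n * infdist x A" using that d by simp
        finally show ?thesis by (simp add: f_def)
      qed
      then show ?thesis using out
        by (intro tendsto_eventually) (auto simp: eventually_sequentially)
    qed
    have conv: "(\<lambda>n. integral\<^sup>L K (f n)) \<longlonglongrightarrow> measure K A"
      if K: "finite_measure K" "sets K = sets borel" for K
    proof -
      interpret K: finite_measure K by fact
      note [measurable_cong] = K(2)
      have [measurable]: "f n \<in> borel_measurable borel" for n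
        by (rule borel_measurable_continuous_onI[OF cont])
      have [measurable]: "A \<in> sets borel" using A by simp
      have "(\<lambda>n. integral\<^sup>L K (f n)) \<longlonglongrightarrow> integral\<^sup>L K (indicator A :: 'a \<Rightarrow> real)"
        by (rule integral_dominated_convergence[where w = "\<lambda>_. 1"]) (simp_all add: lim abs_f)
      then show ?thesis using A K by simp
    qed
    have "(\<lambda>n. integral\<^sup>L M (f n)) = (\<lambda>n. integral\<^sup>L N (f n))" using eq[OF cont rng] by simp
    with conv[OF fin(1) assms(3)] conv[OF fin(2) assms(4)] show ?thesis
      by (metis LIMSEQ_unique)
  qed simp
  interpret M: finite_measure M by fact
  interpret N: finite_measure N by fact
  show ?thesis
  proof (rule measure_eqI_generator_eq[where \<Omega> = UNIV and E = "{A. closed A}" and A = "\<lambda>_. UNIV"])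
    show "Int_stable {A::'a set. closed A}" by (auto simp: Int_stable_def)
    show "sets M = sigma_sets UNIV {A. closed A}" "sets N = sigma_sets UNIV {A. closed A}"
      using assms(3,4) by (simp_all add: borel_eq_closed)
    show "emeasure M A = emeasure N A" if "A \<in> {A. closed A}" for A
      using closed_eq that by (simp add: M.emeasure_eq_measure N.emeasure_eq_measure)
  qed auto
qed

text \<open>
  The monomials in \<open>z\<close> and its conjugate may have both exponents positive, which makes closure
  under multiplication immediate; on the circle they reduce to powers of one of the two.
\<close>

inductive trig_poly :: "(circle \<Rightarrow> complex) \<Rightarrow> bool" where
  monomial: "trig_poly (\<lambda>\<theta>. c * circle_cis \<theta> ^ m * cnj (circle_cis \<theta>) ^ n)"
| add: "trig_poly f \<Longrightarrow> trig_poly g \<Longrightarrow> trig_poly (\<lambda>\<theta>. f \<theta> + g \<theta>)"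

lemma trig_poly_mult:
  assumes "trig_poly f" "trig_poly g"
  shows "trig_poly (\<lambda>\<theta>. f \<theta> * g \<theta>)"
  using assms(1)
proof induction
  case (monomial c m n)
  from assms(2) show ?case
  proof induction
    case (monomial d k l)
    show ?case using trig_poly.monomial[of "c * d" "m + k" "n + l"]
      by (simp add: power_add mult_ac)
  next
    case (add g h)
    then show ?case by (simp add: distrib_left trig_poly.add)
  qed
next
  case (add f h)
  then show ?case by (simp add: distrib_right trig_poly.add)
qed

lemma trig_poly_real_polynomial:
  assumes "real_polynomial_function p"
  shows "trig_poly (\<lambda>\<theta>. of_real (p (circle_cis \<theta>)))"
  using assms
proof induction
  case (linear p)
  define \<alpha> \<beta> where "\<alpha> = p 1 / 2" and "\<beta> = p \<i> / 2"
  \<comment> \<open>Real and imaginary part expressed through \<open>z\<close> and its conjugate.\<close>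
  let ?a = "Complex \<alpha> (- \<beta>)" and ?b = "Complex \<alpha> \<beta>"
  have lin: "linear p" using linear by (rule bounded_linear.linear)
  have "complex_of_real (p z) = ?a * z ^ 1 * cnj z ^ 0 + ?b * z ^ 0 * cnj z ^ 1" for z
  proof -
    have "z = Re z *\<^sub>R 1 + Im z *\<^sub>R \<i>" by (simp add: complex_eq_iff)
    then have "p z = p (Re z *\<^sub>R 1 + Im z *\<^sub>R \<i>)" by (rule arg_cong)
    also have "\<dots> = Re z * p 1 + Im z * p \<i>"
      by (simp only: linear_add[OF lin] linear_scale[OF lin] real_scaleR_def)
    finally have "p z = Re z * (2 * \<alpha>) + Im z * (2 * \<beta>)" by (simp add: \<alpha>_def \<beta>_def)
    then show ?thesis by (simp add: complex_eq_iff algebra_simps)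
  qed
  moreover have "trig_poly (\<lambda>\<theta>. ?a * circle_cis \<theta> ^ 1 * cnj (circle_cis \<theta>) ^ 0 +
      ?b * circle_cis \<theta> ^ 0 * cnj (circle_cis \<theta>) ^ 1)"
    by (intro trig_poly.intros)
  ultimately show ?case by simp
next
  case (const c)
  show ?case using trig_poly.monomial[of "of_real c" 0 0] by simp
next
  case (add f g)
  then show ?case by (simp add: trig_poly.add)
next
  case (mult f g)
  then show ?case by (simp add: trig_poly_mult)
qed

lemma integrable_bounded_circle:
  fixes f :: "circle \<Rightarrow> 'b::{banach, second_countable_topology}"
  assumes "finite_measure \<nu>" "sets \<nu> = sets borel" "f \<in> borel_measurable borel"
    "\<And>\<theta>. norm (f \<theta>) \<le> B"
  shows "integrable \<nu> f"
proof -
  interpret finite_measure \<nu> by fact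
  note [measurable_cong] = assms(2) and [measurable] = assms(3)
  show ?thesis by (rule integrable_const_bound[where B = B]) (use assms(4) in auto)
qed

lemma circle_cis_monomial:
  "circle_cis \<theta> ^ m * cnj (circle_cis \<theta>) ^ n =
    (if n \<le> m then circle_cis \<theta> ^ (m - n) else cnj (circle_cis \<theta>) ^ (n - m))"
proof -
  let ?z = "circle_cis \<theta>" and ?d = "min m n"
  have unit: "?z * cnj ?z = 1" by (simp add: complex_norm_square[symmetric] del: complex_mult_cnj)
  have "?z ^ m * cnj ?z ^ n = (?z ^ ?d * ?z ^ (m - ?d)) * (cnj ?z ^ ?d * cnj ?z ^ (n - ?d))"
    by (simp flip: power_add)
  also have "\<dots> = (?z * cnj ?z) ^ ?d * (?z ^ (m - ?d) * cnj ?z ^ (n - ?d))"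
    by (simp only: power_mult_distrib mult_ac)
  finally show ?thesis by (simp add: unit min_def del: complex_mult_cnj)
qed

text \<open>
  Equal coefficients at \<open>k \<ge> 0\<close> give equal coefficients at all integers by conjugation, hence
  equal integrals of all trigonometric polynomials. By Stone-Weierstrass these are uniformly dense
  in the functions on the circle that extend continuously to the plane, so the two images in the
  plane agree, and the measurable left inverse of the embedding brings them back to the circle.
\<close>

lemma circle_measure_eqI:
  fixes \<mu> \<nu> :: "circle measure"
  assumes \<mu>: "finite_measure \<mu>" "sets \<mu> = sets borel"
    and \<nu>: "finite_measure \<nu>" "sets \<nu> = sets borel"
    and eq: "\<And>k. (LINT \<theta>|\<mu>. cnj (circle_cis \<theta>) ^ k) = (LINT \<theta>|\<nu>. cnj (circle_cis \<theta>) ^ k)"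
  shows "\<mu> = \<nu>"
proof -
  note [measurable_cong] = \<mu>(2) \<nu>(2)
  interpret \<mu>: finite_measure \<mu> by fact
  interpret \<nu>: finite_measure \<nu> by fact
  note integrable = integrable_bounded_circle[OF \<mu>] integrable_bounded_circle[OF \<nu>]
  have conj: "(LINT \<theta>|K. circle_cis \<theta> ^ k) = cnj (LINT \<theta>|K. cnj (circle_cis \<theta>) ^ k)"
    for K :: "circle measure" and k
    using Bochner_Integration.integral_cnj[of K "\<lambda>\<theta>. cnj (circle_cis \<theta>) ^ k"] by simp
  have pos: "(LINT \<theta>|\<mu>. circle_cis \<theta> ^ k) = (LINT \<theta>|\<nu>. circle_cis \<theta> ^ k)" for k
    by (simp only: conj eq)
  have trig: "integrable \<mu> f \<and> integrable \<nu> f \<and> integral\<^sup>L \<mu> f = integral\<^sup>L \<nu> f"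
    if "trig_poly f" for f
    using that
  proof induction
    case (monomial c m n)
    have "(\<lambda>\<theta>. c * circle_cis \<theta> ^ m * cnj (circle_cis \<theta>) ^ n) =
      (if n \<le> m then (\<lambda>\<theta>. c * circle_cis \<theta> ^ (m - n)) else (\<lambda>\<theta>. c * cnj (circle_cis \<theta>) ^ (n - m)))"
      by (auto simp: mult.assoc circle_cis_monomial)
    moreover have "integrable \<mu> (\<lambda>\<theta>. c * circle_cis \<theta> ^ m * cnj (circle_cis \<theta>) ^ n)"
      "integrable \<nu> (\<lambda>\<theta>. c * circle_cis \<theta> ^ m * cnj (circle_cis \<theta>) ^ n)"
      by (rule integrable[where B = "cmod c"]; measurable?; simp add: norm_mult norm_power)+
    ultimately show ?case using eq pos by auto
  next
    case (add f g)
    then show ?case by simp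
  qed
  have "distr \<mu> borel circle_cis = distr \<nu> borel circle_cis"
  proof (rule finite_borel_measure_eqI)
    show "finite_measure (distr \<mu> borel circle_cis)" "finite_measure (distr \<nu> borel circle_cis)"
      by (auto intro!: \<mu>.finite_measure_distr \<nu>.finite_measure_distr)
    fix f :: "complex \<Rightarrow> real"
    assume f: "continuous_on UNIV f" "range f \<subseteq> {0..1}"
    have [measurable]: "f \<in> borel_measurable borel"
      by (rule borel_measurable_continuous_onI[OF f(1)])
    let ?f = "\<lambda>\<theta>. f (circle_cis \<theta>)"
    have f01: "0 \<le> f z" "f z \<le> 1" for z using range_subsetD[OF f(2), of z] by auto
    have int_f: "integrable \<mu> ?f" "integrable \<nu> ?f"
      by (auto intro!: integrable[where B = 1] simp: f01)
    let ?m = "measure \<mu> (space \<mu>) + measure \<nu> (space \<nu>) + 1"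
    have m: "?m > 0" by (simp add: add_nonneg_pos)
    have "\<bar>integral\<^sup>L \<mu> ?f - integral\<^sup>L \<nu> ?f\<bar> \<le> e" if "e > 0" for e
    proof -
      define \<delta> where "\<delta> = e / ?m"
      have \<delta>: "\<delta> > 0" "\<delta> * ?m = e" using m that by (auto simp: \<delta>_def)
      obtain p where p: "real_polynomial_function p" "\<And>z. z \<in> sphere 0 1 \<Longrightarrow> \<bar>f z - p z\<bar> < \<delta>"
        using Stone_Weierstrass_real_polynomial_function[of "sphere 0 1" f \<delta>]
          continuous_on_subset[OF f(1)] \<delta>(1) by auto
      let ?p = "\<lambda>\<theta>. p (circle_cis \<theta>)"
      have "continuous_on UNIV p"
        using p(1) continuous_on_polymonial_function real_polynomial_function_eq by blast
      then have [measurable]: "p \<in> borel_measurable borel"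
        by (rule borel_measurable_continuous_onI)
      have "integrable \<mu> (\<lambda>\<theta>. complex_of_real (?p \<theta>))" "integrable \<nu> (\<lambda>\<theta>. complex_of_real (?p \<theta>))"
        and eqC: "(LINT \<theta>|\<mu>. complex_of_real (?p \<theta>)) = (LINT \<theta>|\<nu>. complex_of_real (?p \<theta>))"
        using trig[OF trig_poly_real_polynomial[OF p(1)]] by auto
      from this(1,2)[THEN integrable_Re] have int_p: "integrable \<mu> ?p" "integrable \<nu> ?p" by auto
      have eq_p: "integral\<^sup>L \<mu> ?p = integral\<^sup>L \<nu> ?p" using eqC by simp
      have near: "\<bar>?f \<theta> - ?p \<theta>\<bar> \<le> \<delta>" for \<theta> using p(2)[of "circle_cis \<theta>"] by simp
      have "\<bar>integral\<^sup>L \<mu> ?f - integral\<^sup>L \<mu> ?p\<bar> \<le> (LINT \<theta>|\<mu>. \<bar>?f \<theta> - ?p \<theta>\<bar>)"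
        using int_f int_p by (simp flip: Bochner_Integration.integral_diff)
      also have "\<dots> \<le> (LINT \<theta>|\<mu>. \<delta>)" using int_f int_p near by (intro integral_mono) auto
      finally have 1: "\<bar>integral\<^sup>L \<mu> ?f - integral\<^sup>L \<mu> ?p\<bar> \<le> measure \<mu> (space \<mu>) * \<delta>" by simp
      have "\<bar>integral\<^sup>L \<nu> ?f - integral\<^sup>L \<nu> ?p\<bar> \<le> (LINT \<theta>|\<nu>. \<bar>?f \<theta> - ?p \<theta>\<bar>)"
        using int_f int_p by (simp flip: Bochner_Integration.integral_diff)
      also have "\<dots> \<le> (LINT \<theta>|\<nu>. \<delta>)" using int_f int_p near by (intro integral_mono) auto
      finally have 2: "\<bar>integral\<^sup>L \<nu> ?f - integral\<^sup>L \<nu> ?p\<bar> \<le> measure \<nu> (space \<nu>) * \<delta>" by simp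
      have "(measure \<mu> (space \<mu>) + measure \<nu> (space \<nu>)) * \<delta> \<le> e"
        using \<delta> by (simp add: algebra_simps)
      then show ?thesis using 1 2 eq_p by (simp add: algebra_simps)
    qed
    then have "\<bar>integral\<^sup>L \<mu> ?f - integral\<^sup>L \<nu> ?f\<bar> \<le> 0" by (rule field_le_epsilon) simp
    then show "integral\<^sup>L (distr \<mu> borel circle_cis) f = integral\<^sup>L (distr \<nu> borel circle_cis) f"
      by (simp add: integral_distr)
  qed simp_all
  then have "distr (distr \<mu> borel circle_cis) borel (\<lambda>z. to_circle (Im (Ln z))) =
      distr (distr \<nu> borel circle_cis) borel (\<lambda>z. to_circle (Im (Ln z)))" by simp
  then have "distr \<mu> borel (\<lambda>\<theta>. \<theta>) = distr \<nu> borel (\<lambda>\<theta>. \<theta>)"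
    by (subst (asm) (1 2) distr_distr) (auto simp: comp_def)
  then show ?thesis by (simp add: distr_id2 \<mu>(2) \<nu>(2))
qed

section \<open>The analytic density\<close>

text \<open>
  The Taylor series of a holomorphic function at a real point, restricted to the real line, has
  real increments; taking real parts of its coefficients gives a real power series.
\<close>

lemma real_analytic_at_Re:
  assumes "G holomorphic_on U" "open U" "of_real x \<in> U"
  shows "real_analytic_at (\<lambda>t. Re (G (of_real t))) x"
proof -
  obtain r where r: "r > 0" "ball (of_real x) r \<subseteq> U"
    using assms(2,3) openE by blast
  define a where "a = (\<lambda>n. (deriv ^^ n) G (of_real x) / fact n)"
  have "(\<lambda>n. Re (a n) * (y - x) ^ n) sums Re (G (of_real y))" if "\<bar>y - x\<bar> < r" for y
  proof -
    have "cmod (of_real y - of_real x) < r" using that by (simp flip: of_real_diff)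
    then have "of_real y \<in> ball (complex_of_real x) r"
      by (simp add: dist_norm norm_minus_commute)
    then have "(\<lambda>n. a n * (of_real y - of_real x) ^ n) sums G (of_real y)"
      unfolding a_def
      using holomorphic_power_series[OF holomorphic_on_subset[OF assms(1) r(2)]] by blast
    then have "(\<lambda>n. Re (a n * of_real ((y - x) ^ n))) sums Re (G (of_real y))"
      by (intro sums_Re) simp
    then show ?thesis by simp
  qed
  then have "\<forall>y. \<bar>y - x\<bar> < r \<longrightarrow> (\<lambda>n. Re (a n) * (y - x) ^ n) sums Re (G (of_real y))"
    by simp
  with r(1) show ?thesis
    unfolding real_analytic_at_def by (intro exI[of _ r] exI[of _ "\<lambda>n. Re (a n)"] conjI)
qed

lemma integral_circle_cis_power:
  "(LINT \<theta>|circle_lebesgue. circle_cis \<theta> ^ n) = (if n = 0 then 2 * pi else 0)"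
proof -
  define g where "g = (\<lambda>x. cis (real n * x))"
  define H where "H = (\<lambda>w :: complex. if n = 0 then w else exp (\<i> * of_nat n * w) / (\<i> * of_nat n))"
  define G where "G = (\<lambda>x. H (of_real x))"
  have "(H has_field_derivative g x) (at (of_real x))" for x
  proof (cases "n = 0")
    case True
    then show ?thesis by (simp add: H_def g_def)
  next
    case False
    then show ?thesis
      by (auto simp: H_def g_def cis_conv_exp mult_ac intro!: derivative_eq_intros)
  qed
  then have G: "(G has_vector_derivative g x) (at x within {0..2 * pi})" for x
    unfolding G_def by (rule has_vector_derivative_real_field)
  have "has_bochner_integral lborel (\<lambda>x. indicator {0..2 * pi} x *\<^sub>R g x) (G (2 * pi) - G 0)"
    by (rule has_bochner_integral_FTC_Icc)
      (use G in \<open>auto simp: g_def intro!: continuous_intros\<close>)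
  then have closed: "(LINT x|lborel. indicator {0..2 * pi} x *\<^sub>R g x) = G (2 * pi) - G 0"
    by (rule has_bochner_integral_integral_eq)
  have [measurable]: "g \<in> borel_measurable borel"
    unfolding g_def by (intro borel_measurable_continuous_onI continuous_intros)
  have "(LINT \<theta>|circle_lebesgue. circle_cis \<theta> ^ n) =
      (LINT x|restrict_space lborel {0..<2 * pi}. circle_cis (to_circle x) ^ n)"
    unfolding circle_lebesgue_def by (rule integral_distr) (auto intro: measurable_restrict_space1)
  also have "\<dots> = (LINT x|lborel. indicator {0..<2 * pi} x *\<^sub>R g x)"
    by (simp add: integral_restrict_space g_def Complex.DeMoivre)
  \<comment> \<open>The half-open fundamental domain differs by a null set from the interval of the
     fundamental theorem of calculus.\<close>
  also have "\<dots> = (LINT x|lborel. indicator {0..2 * pi} x *\<^sub>R g x)"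
    by (intro integral_cong_AE, measurable)
      (use AE_lborel_singleton[of "2 * pi"] in eventually_elim, auto split: split_indicator)
  also have "\<dots> = G (2 * pi) - G 0" by (rule closed)
  also have "\<dots> = (if n = 0 then 2 * pi else 0)"
  proof -
    have "exp (\<i> * of_nat n * of_real (2 * pi)) = cis (2 * pi * real n)"
      by (simp add: cis_conv_exp mult_ac)
    also have "\<dots> = 1" by (rule cis_multiple_2pi) simp
    finally show ?thesis by (simp add: G_def H_def)
  qed
  finally show ?thesis .
qed

lemma integral_circle_monomial:
  "(LINT \<theta>|circle_lebesgue. circle_cis \<theta> ^ k * cnj (circle_cis \<theta>) ^ m) =
    (if k = m then 2 * pi else 0)"
proof (cases "m \<le> k")
  case True
  then show ?thesis by (simp add: circle_cis_monomial integral_circle_cis_power)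
next
  case False
  then have "(LINT \<theta>|circle_lebesgue. circle_cis \<theta> ^ k * cnj (circle_cis \<theta>) ^ m) =
    (LINT \<theta>|circle_lebesgue. cnj (circle_cis \<theta> ^ (m - k)))"
    by (simp add: circle_cis_monomial)
  also have "\<dots> = cnj (LINT \<theta>|circle_lebesgue. circle_cis \<theta> ^ (m - k))" by (rule Bochner_Integration.integral_cnj)
  finally show ?thesis using False by (simp add: integral_circle_cis_power)
qed

text \<open>
  The difference of the two sides is the Poisson kernel
  \<open>(1 - \<bar>u\<bar>\<^sup>2) / \<bar>1 - u\<bar>\<^sup>2\<close>.
\<close>

lemma two_Re_inverse_one_minus_ge:
  assumes "cmod u < 1"
  shows "1 \<le> 2 * Re (1 / (1 - u))"
proof -
  have "1 - u \<noteq> 0" using assms by auto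
  then have pos: "0 < (1 - Re u)\<^sup>2 + (Im u)\<^sup>2"
    by (auto simp: complex_eq_iff sum_power2_gt_zero_iff)
  have "(cmod u)\<^sup>2 \<le> 1\<^sup>2" using assms by (intro power_mono) auto
  then have "(Re u)\<^sup>2 + (Im u)\<^sup>2 \<le> 1" by (simp add: cmod_power2)
  then have "(1 - Re u)\<^sup>2 + (Im u)\<^sup>2 \<le> 2 * (1 - Re u)"
    by (simp add: power2_eq_square algebra_simps)
  then show ?thesis using pos by (simp add: Re_divide field_simps)
qed

text \<open>The Weierstrass M-test, integrated term by term.\<close>

lemma sums_integral_circle:
  fixes K :: "circle measure" and g :: "nat \<Rightarrow> circle \<Rightarrow> complex"
  assumes K: "finite_measure K" "sets K = sets borel"
    and [measurable]: "\<And>k. g k \<in> borel_measurable borel"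
    and bound: "\<And>k \<theta>. cmod (g k \<theta>) \<le> b k" and b: "summable b"
  shows "(\<lambda>k. LINT \<theta>|K. g k \<theta>) sums (LINT \<theta>|K. (\<Sum>k. g k \<theta>))"
proof (rule sums_integral)
  interpret finite_measure K by fact
  note [measurable_cong] = K(2)
  show int: "integrable K (g k)" for k
    by (rule integrable_bounded_circle[OF K, where B = "b k"]) (simp_all add: bound)
  show "AE \<theta> in K. summable (\<lambda>k. norm (g k \<theta>))"
    by (intro AE_I2 summable_comparison_test'[OF b]) (simp add: bound)
  show "summable (\<lambda>k. LINT \<theta>|K. norm (g k \<theta>))"
  proof (rule summable_comparison_test')
    show "summable (\<lambda>k. b k * measure K (space K))" using b by (rule summable_mult2)
    have "(LINT \<theta>|K. norm (g k \<theta>)) \<le> (LINT \<theta>|K. b k)" for k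
      using int[of k] bound by (intro integral_mono integrable_norm) auto
    then show "norm (LINT \<theta>|K. norm (g k \<theta>)) \<le> b k * measure K (space K)" for k
      by (simp add: mult.commute)
  qed
qed

text \<open>
  The tree enters only through the decay of the Fourier coefficients; the rest is a statement on
  single measures on the circle, in which \<open>s\<close> is the radius of convergence to be gained.
\<close>

locale decaying_circle_measure = finite_measure \<nu> for \<nu> :: "circle measure" +
  fixes s C :: real
  assumes sets_eq: "sets \<nu> = sets borel"
    and s_gt_1: "1 < s"
    and decay: "\<And>k. cmod (LINT \<theta>|\<nu>. cnj (circle_cis \<theta>) ^ k) \<le> C / s ^ k"
begin

definition coeff :: "nat \<Rightarrow> complex" where
  "coeff k = (LINT \<theta>|\<nu>. cnj (circle_cis \<theta>) ^ k)"

definition coeff_series :: "complex \<Rightarrow> complex" where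
  "coeff_series z = (\<Sum>k. coeff k * z ^ k)"

text \<open>
  The Fourier series of \<open>\<nu>\<close>, summed over all integers. It is written as the real part of one
  expression holomorphic in \<open>z\<close>, so that analyticity can be read off.
\<close>

definition dens :: "circle \<Rightarrow> real" where
  "dens \<theta> = Re ((2 * coeff_series (circle_cis \<theta>) - coeff 0) / of_real (2 * pi))"

lemma coeff_0: "coeff 0 = of_real (measure \<nu> (space \<nu>))"
  by (simp add: coeff_def scaleR_conv_of_real)

lemma sums_coeff_series:
  assumes "cmod z < s"
  shows "(\<lambda>k. coeff k * z ^ k) sums coeff_series z"
  unfolding coeff_series_def
proof (rule summable_sums, rule summable_comparison_test')
  show "summable (\<lambda>k. C * (cmod z / s) ^ k)"
    using assms s_gt_1 by (intro summable_mult summable_geometric) auto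
  show "norm (coeff k * z ^ k) \<le> C * (cmod z / s) ^ k" for k
    using mult_right_mono[OF decay[of k], of "cmod z ^ k"]
    by (simp add: coeff_def norm_mult norm_power power_divide)
qed

lemma coeff_series_holomorphic: "coeff_series holomorphic_on ball 0 s"
proof (rule power_series_holomorphic)
  show "(\<lambda>k. coeff k * (z - 0) ^ k) sums coeff_series z" if "z \<in> ball 0 s" for z
    using sums_coeff_series[of z] that by simp
qed

lemma continuous_coeff_series: "continuous_on (ball 0 s) coeff_series"
  by (rule holomorphic_on_imp_continuous_on[OF coeff_series_holomorphic])

lemma measurable_coeff_series [measurable]: "(\<lambda>\<theta>. coeff_series (circle_cis \<theta>)) \<in> borel_measurable borel"
proof (rule borel_measurable_continuous_onI)
  show "continuous_on UNIV (\<lambda>\<theta>. coeff_series (circle_cis \<theta>))"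
    by (rule continuous_on_compose2[OF continuous_coeff_series continuous_circle_cis]) (use s_gt_1 in auto)
qed

lemma measurable_dens [measurable]: "dens \<in> borel_measurable borel"
  unfolding dens_def by measurable

lemma dens_eq: "dens \<theta> = (2 * Re (coeff_series (circle_cis \<theta>)) - Re (coeff 0)) / (2 * pi)"
  unfolding dens_def Re_divide_of_real by simp

lemma dens_analytic: "real_analytic_on_circle dens"
  unfolding real_analytic_on_circle_def
proof
  fix x :: real
  let ?U = "(\<lambda>w. exp (\<i> * w)) -` ball 0 s"
  have "(\<lambda>w. coeff_series (exp (\<i> * w))) holomorphic_on ?U"
    by (rule holomorphic_on_compose_gen[OF _ coeff_series_holomorphic, unfolded o_def])
      (auto intro!: holomorphic_intros)
  then have "(\<lambda>w. (2 * coeff_series (exp (\<i> * w)) - coeff 0) / of_real (2 * pi)) holomorphic_on ?U"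
    by (intro holomorphic_intros) auto
  moreover have "open ?U" by (intro open_vimage continuous_intros) auto
  moreover have "of_real x \<in> ?U" using s_gt_1 by simp
  ultimately have "real_analytic_at
      (\<lambda>t. Re ((2 * coeff_series (exp (\<i> * of_real t)) - coeff 0) / of_real (2 * pi))) x"
    by (rule real_analytic_at_Re)
  then show "real_analytic_at (dens \<circ> to_circle) x"
    unfolding dens_def o_def circle_cis_to_circle cis_conv_exp .
qed

text \<open>
  Summing the geometric series under the integral turns \<open>2 * F z - c 0\<close> into the integral of the
  Herglotz kernel, whose real part, the Poisson kernel, is nonnegative.
\<close>

lemma coeff_0_le_two_Re_coeff_series:
  assumes z: "cmod z < 1"
  shows "Re (coeff 0) \<le> 2 * Re (coeff_series z)"
proof -
  let ?u = "\<lambda>\<omega>. z * cnj (circle_cis \<omega>)"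
  have norm_u: "cmod (?u \<omega>) = cmod z" for \<omega> by (simp add: norm_mult)
  have u_1: "cmod (?u \<omega>) < 1" for \<omega> by (simp add: norm_u z)
  have "(\<lambda>k. LINT \<omega>|\<nu>. ?u \<omega> ^ k) sums (LINT \<omega>|\<nu>. (\<Sum>k. ?u \<omega> ^ k))"
  proof (rule sums_integral_circle[OF finite_measure_axioms sets_eq])
    show "cmod (?u \<omega> ^ k) \<le> cmod z ^ k" for k \<omega>
      by (simp add: norm_power norm_u)
    show "summable (\<lambda>k. cmod z ^ k)" using z by (intro summable_geometric) auto
  qed measurable
  moreover have "(\<Sum>k. ?u \<omega> ^ k) = 1 / (1 - ?u \<omega>)" for \<omega>
    by (rule suminf_geometric[OF u_1])
  moreover have "(LINT \<omega>|\<nu>. ?u \<omega> ^ k) = coeff k * z ^ k" for k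
    by (simp add: power_mult_distrib coeff_def mult.commute)
  ultimately have "(\<lambda>k. coeff k * z ^ k) sums (LINT \<omega>|\<nu>. 1 / (1 - ?u \<omega>))" by simp
  moreover have "(\<lambda>k. coeff k * z ^ k) sums coeff_series z"
    using z s_gt_1 by (intro sums_coeff_series) simp
  ultimately have series_eq: "coeff_series z = (LINT \<omega>|\<nu>. 1 / (1 - ?u \<omega>))"
    using sums_unique2 by blast
  have int: "integrable \<nu> (\<lambda>\<omega>. 1 / (1 - ?u \<omega>))"
  proof (rule integrable_bounded_circle[OF finite_measure_axioms sets_eq])
    show "norm (1 / (1 - ?u \<omega>)) \<le> 1 / (1 - cmod z)" for \<omega>
    proof -
      have "1 - cmod z \<le> cmod (1 - ?u \<omega>)"
        using norm_triangle_ineq2[of 1 "?u \<omega>"] unfolding norm_u by simp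
      then show ?thesis using z by (simp add: norm_divide frac_le)
    qed
  qed measurable
  have "2 * Re (coeff_series z) - Re (coeff 0) = (LINT \<omega>|\<nu>. 2 * Re (1 / (1 - ?u \<omega>)) - 1)"
    unfolding series_eq coeff_0 integral_Re[OF int, symmetric] using integrable_Re[OF int]
    by (subst Bochner_Integration.integral_diff) simp_all
  also have "\<dots> \<ge> 0"
    using two_Re_inverse_one_minus_ge[OF u_1] by (intro integral_nonneg_AE AE_I2) simp
  finally show ?thesis by simp
qed

text \<open>
  The positivity inside the disc passes to the boundary along a radius, since the series is
  continuous up to and beyond the unit circle.
\<close>

lemma dens_nonneg: "0 \<le> dens \<theta>"
proof -
  let ?z = "circle_cis \<theta>" and ?r = "\<lambda>n. real n / real (Suc n)"
  have norm_rz: "cmod (of_real (?r n) * ?z) = ?r n" for n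
    by (simp only: norm_mult norm_circle_cis norm_of_real) simp
  have z_in: "of_real (?r n) * ?z \<in> ball 0 1" for n
    unfolding mem_ball_0 norm_rz by simp
  have "(\<lambda>n. of_real (?r n) * ?z) \<longlonglongrightarrow> of_real 1 * ?z"
    by (intro tendsto_intros LIMSEQ_n_over_Suc_n)
  moreover have "of_real (?r n) * ?z \<in> ball 0 s" for n
    using z_in[of n] s_gt_1 unfolding mem_ball_0 by linarith
  ultimately have "(\<lambda>n. coeff_series (of_real (?r n) * ?z)) \<longlonglongrightarrow> coeff_series (of_real 1 * ?z)"
    using s_gt_1 by (intro continuous_on_tendsto_compose[OF continuous_coeff_series]) auto
  then have lim: "(\<lambda>n. 2 * Re (coeff_series (of_real (?r n) * ?z))) \<longlonglongrightarrow> 2 * Re (coeff_series (of_real 1 * ?z))"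
    by (intro tendsto_intros)
  have "Re (coeff 0) \<le> 2 * Re (coeff_series (of_real (?r n) * ?z))" for n
    using z_in[of n] unfolding mem_ball_0 by (rule coeff_0_le_two_Re_coeff_series)
  then have "Re (coeff 0) \<le> 2 * Re (coeff_series (of_real 1 * ?z))"
    by (intro LIMSEQ_le_const[OF lim] exI allI impI)
  then show ?thesis by (simp add: dens_eq)
qed

lemma summable_bound: "summable (\<lambda>k. C / s ^ k)"
proof -
  have "summable (\<lambda>k. C * (1 / s) ^ k)"
    using s_gt_1 by (intro summable_mult summable_geometric) auto
  then show ?thesis by (simp add: power_divide)
qed

lemma norm_coeff: "cmod (coeff k) \<le> C / s ^ k"
  unfolding coeff_def by (rule decay)

lemma norm_coeff_series: "cmod (coeff_series (circle_cis \<theta>)) \<le> (\<Sum>k. C / s ^ k)"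
  unfolding coeff_series_def using norm_coeff summable_bound
  by (intro norm_suminf_le) (simp_all add: norm_mult norm_power)

lemma sums_integral_coeff_series:
  assumes [measurable]: "h \<in> borel_measurable borel" and h: "\<And>\<theta>. cmod (h \<theta>) \<le> 1"
  shows "(\<lambda>k. coeff k * (LINT \<theta>|circle_lebesgue. circle_cis \<theta> ^ k * h \<theta>)) sums
      (LINT \<theta>|circle_lebesgue. coeff_series (circle_cis \<theta>) * h \<theta>)"
proof -
  have "(\<lambda>k. LINT \<theta>|circle_lebesgue. coeff k * (circle_cis \<theta> ^ k * h \<theta>)) sums
      (LINT \<theta>|circle_lebesgue. (\<Sum>k. coeff k * (circle_cis \<theta> ^ k * h \<theta>)))"
  proof (rule sums_integral_circle[OF finite_circle_lebesgue sets_circle_lebesgue _ _ summable_bound])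
    show "cmod (coeff k * (circle_cis \<theta> ^ k * h \<theta>)) \<le> C / s ^ k" for k \<theta>
    proof -
      have "cmod (coeff k * (circle_cis \<theta> ^ k * h \<theta>)) \<le> cmod (coeff k) * 1"
        using h[of \<theta>] by (simp add: norm_mult norm_power mult_left_le)
      also have "\<dots> \<le> C / s ^ k" using norm_coeff by simp
      finally show ?thesis .
    qed
  qed measurable
  moreover have "(\<Sum>k. coeff k * (circle_cis \<theta> ^ k * h \<theta>)) = coeff_series (circle_cis \<theta>) * h \<theta>" for \<theta>
  proof -
    have "(\<lambda>k. coeff k * circle_cis \<theta> ^ k * h \<theta>) sums (coeff_series (circle_cis \<theta>) * h \<theta>)"
      using s_gt_1 by (intro sums_mult2 sums_coeff_series) simp
    then show ?thesis by (simp add: mult.assoc sums_iff)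
  qed
  ultimately show ?thesis by simp
qed

lemma coeff_series_fourier:
  "(LINT \<theta>|circle_lebesgue. coeff_series (circle_cis \<theta>) * cnj (circle_cis \<theta>) ^ m) = of_real (2 * pi) * coeff m"
proof -
  have "(\<lambda>k. coeff k * (LINT \<theta>|circle_lebesgue. circle_cis \<theta> ^ k * cnj (circle_cis \<theta>) ^ m)) sums
      (LINT \<theta>|circle_lebesgue. coeff_series (circle_cis \<theta>) * cnj (circle_cis \<theta>) ^ m)"
    by (rule sums_integral_coeff_series) (simp_all add: norm_power)
  moreover have "coeff k * (LINT \<theta>|circle_lebesgue. circle_cis \<theta> ^ k * cnj (circle_cis \<theta>) ^ m) =
      (if k = m then of_real (2 * pi) * coeff m else 0)" for k
    by (simp add: integral_circle_monomial)
  ultimately have "(\<lambda>k. if k = m then of_real (2 * pi) * coeff m else 0) sums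
      (LINT \<theta>|circle_lebesgue. coeff_series (circle_cis \<theta>) * cnj (circle_cis \<theta>) ^ m)"
    by simp
  moreover have "(\<lambda>k. if k = m then of_real (2 * pi) * coeff m else 0) sums (of_real (2 * pi) * coeff m)"
    by (rule sums_single[of m "\<lambda>_. of_real (2 * pi) * coeff m"])
  ultimately show ?thesis by (rule sums_unique2)
qed

text \<open>
  The conjugate series carries the coefficients at nonpositive indices only, so among the
  \<open>m \<ge> 0\<close> it contributes only at 0, where the constant subtracted in \<^const>\<open>dens\<close> cancels it.
\<close>

lemma cnj_coeff_series_fourier:
  "(LINT \<theta>|circle_lebesgue. cnj (coeff_series (circle_cis \<theta>)) * cnj (circle_cis \<theta>) ^ m) =
    (if m = 0 then of_real (2 * pi) * coeff 0 else 0)"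
proof -
  let ?a = "if m = 0 then of_real (2 * pi) * coeff 0 else 0"
  have "(\<lambda>k. coeff k * (LINT \<theta>|circle_lebesgue. circle_cis \<theta> ^ k * circle_cis \<theta> ^ m)) sums
      (LINT \<theta>|circle_lebesgue. coeff_series (circle_cis \<theta>) * circle_cis \<theta> ^ m)"
    by (rule sums_integral_coeff_series) (simp_all add: norm_power)
  moreover have summand: "coeff k * (LINT \<theta>|circle_lebesgue. circle_cis \<theta> ^ k * circle_cis \<theta> ^ m) =
      (if k = 0 then ?a else 0)" for k
    by (simp add: integral_circle_cis_power flip: power_add)
  ultimately have "(\<lambda>k. if k = 0 then ?a else 0) sums
      (LINT \<theta>|circle_lebesgue. coeff_series (circle_cis \<theta>) * circle_cis \<theta> ^ m)"
    by (simp only: summand)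
  moreover have "(\<lambda>k. if k = 0 then ?a else 0) sums ?a"
    by (rule sums_single[of 0 "\<lambda>_. ?a"])
  ultimately have "(LINT \<theta>|circle_lebesgue. coeff_series (circle_cis \<theta>) * circle_cis \<theta> ^ m) = ?a"
    by (rule sums_unique2)
  moreover have "(LINT \<theta>|circle_lebesgue. cnj (coeff_series (circle_cis \<theta>)) * cnj (circle_cis \<theta>) ^ m) =
      cnj (LINT \<theta>|circle_lebesgue. coeff_series (circle_cis \<theta>) * circle_cis \<theta> ^ m)"
    using Bochner_Integration.integral_cnj[of circle_lebesgue
        "\<lambda>\<theta>. coeff_series (circle_cis \<theta>) * circle_cis \<theta> ^ m"] by simp
  ultimately show ?thesis by (simp add: coeff_0)
qed

lemma dens_fourier:
  "(LINT \<theta>|circle_lebesgue. dens \<theta> *\<^sub>R cnj (circle_cis \<theta>) ^ m) = coeff m"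
proof -
  let ?w = "\<lambda>\<theta>. cnj (circle_cis \<theta>) ^ m"
  let ?A = "\<lambda>\<theta>. coeff_series (circle_cis \<theta>) * ?w \<theta>" and ?B = "\<lambda>\<theta>. cnj (coeff_series (circle_cis \<theta>)) * ?w \<theta>"
  have two_Re: "complex_of_real (dens \<theta>) * of_real (2 * pi) =
      coeff_series (circle_cis \<theta>) + cnj (coeff_series (circle_cis \<theta>)) - coeff 0" for \<theta>
    by (simp add: dens_eq coeff_0 complex_eq_iff)
  have dens_expand: "of_real (2 * pi) * (dens \<theta> *\<^sub>R ?w \<theta>) = ?A \<theta> + ?B \<theta> - coeff 0 * ?w \<theta>" for \<theta>
  proof -
    have "of_real (2 * pi) * (dens \<theta> *\<^sub>R ?w \<theta>) = (complex_of_real (dens \<theta>) * of_real (2 * pi)) * ?w \<theta>"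
      by (simp add: scaleR_conv_of_real mult_ac)
    then show ?thesis by (simp only: two_Re ring_distribs)
  qed
  note bounded = integrable_bounded_circle[OF finite_circle_lebesgue sets_circle_lebesgue]
  have A: "integrable circle_lebesgue ?A"
    by (rule bounded[where B = "\<Sum>k. C / s ^ k"], measurable) (simp add: norm_mult norm_power norm_coeff_series)
  have B: "integrable circle_lebesgue ?B"
    by (rule bounded[where B = "\<Sum>k. C / s ^ k"], measurable) (simp add: norm_mult norm_power norm_coeff_series)
  have W: "integrable circle_lebesgue (\<lambda>\<theta>. coeff 0 * ?w \<theta>)"
    by (rule bounded[where B = "cmod (coeff 0)"], measurable) (simp add: norm_mult norm_power)
  have W_eq: "(LINT \<theta>|circle_lebesgue. coeff 0 * ?w \<theta>) = (if m = 0 then of_real (2 * pi) * coeff 0 else 0)"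
    using integral_circle_monomial[of 0 m] by simp
  have "of_real (2 * pi) * (LINT \<theta>|circle_lebesgue. dens \<theta> *\<^sub>R ?w \<theta>) =
      (LINT \<theta>|circle_lebesgue. ?A \<theta> + ?B \<theta> - coeff 0 * ?w \<theta>)"
    by (simp only: integral_mult_right_zero[symmetric] dens_expand)
  also have "\<dots> = of_real (2 * pi) * coeff m"
    by (simp only: Bochner_Integration.integral_diff[OF Bochner_Integration.integrable_add[OF A B] W]
        Bochner_Integration.integral_add[OF A B] coeff_series_fourier cnj_coeff_series_fourier W_eq add_diff_cancel_right')
  finally show ?thesis by simp
qed

lemma density_dens: "density circle_lebesgue (\<lambda>\<theta>. ennreal (dens \<theta>)) = \<nu>"
proof (rule circle_measure_eqI)
  have "\<bar>2 * Re (coeff_series (circle_cis \<theta>)) - Re (coeff 0)\<bar> \<le> 2 * (\<Sum>k. C / s ^ k) + cmod (coeff 0)" for \<theta>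
    using abs_Re_le_cmod[of "coeff_series (circle_cis \<theta>)"] abs_Re_le_cmod[of "coeff 0"] norm_coeff_series[of \<theta>] by linarith
  then have "norm (dens \<theta>) \<le> (2 * (\<Sum>k. C / s ^ k) + cmod (coeff 0)) / (2 * pi)" for \<theta>
    by (simp add: dens_eq divide_right_mono)
  then have "integrable circle_lebesgue dens"
    by (rule integrable_bounded_circle[OF finite_circle_lebesgue sets_circle_lebesgue measurable_dens])
  then have "(\<integral>\<^sup>+\<theta>. ennreal (dens \<theta>) \<partial>circle_lebesgue) < \<infinity>"
    by (simp add: nn_integral_eq_integral dens_nonneg)
  moreover have "emeasure (density circle_lebesgue (\<lambda>\<theta>. ennreal (dens \<theta>))) (space circle_lebesgue) =
      (\<integral>\<^sup>+\<theta>. ennreal (dens \<theta>) \<partial>circle_lebesgue)"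
    by (subst emeasure_density) (simp_all add: circle_lebesgue_def)
  ultimately show "finite_measure (density circle_lebesgue (\<lambda>\<theta>. ennreal (dens \<theta>)))"
    by (intro finite_measureI) simp
  show "(LINT \<theta>|density circle_lebesgue (\<lambda>\<theta>. ennreal (dens \<theta>)). cnj (circle_cis \<theta>) ^ k) =
      (LINT \<theta>|\<nu>. cnj (circle_cis \<theta>) ^ k)" for k
    using dens_fourier[of k] by (subst integral_density) (simp_all add: dens_nonneg coeff_def)
qed (simp_all add: sets_eq finite_measure_axioms)

end

theorem corollary1p3:
  fixes M :: "'w measure" and q :: nat
    and X :: "nat list \<Rightarrow> 'w \<Rightarrow> complex" and \<nu> :: "circle measure"
  assumes "q \<ge> 2"
    and "prob_space M"
    and "branching_type_stationary M q X"
    and "is_tree_spectral_measure M q X \<nu>"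
  shows "absolutely_continuous circle_lebesgue \<nu> \<and>
    (\<exists>f. real_analytic_on_circle f \<and> (\<forall>\<theta>. 0 \<le> f \<theta>) \<and>
         (AE \<theta> in circle_lebesgue. RN_deriv circle_lebesgue \<nu> \<theta> = ennreal (f \<theta>)))"
proof -
  have "0 < q" using assms(1) by simp
  moreover have "[] \<in> tree_vertices q" by (simp add: tree_vertices_def)
  ultimately obtain \<xi> where \<xi>: "\<xi> \<in> rooted_rays q" using rooted_ray_through_vertex by blast
  with assms(4) have "radon_measure \<nu>"
    by (simp add: is_tree_spectral_measure_def is_spectral_measure_def)
  then have fin: "finite_measure \<nu>" and sets: "sets \<nu> = sets borel"
    by (simp_all add: finite_radon_measure_circle) (simp add: radon_measure_def)
  interpret decaying_circle_measure \<nu> "sqrt q" "measure \<nu> (space \<nu>)"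
  proof (intro decaying_circle_measure.intro decaying_circle_measure_axioms.intro)
    show "cmod (LINT \<theta>|\<nu>. cnj (circle_cis \<theta>) ^ k) \<le> measure \<nu> (space \<nu>) / sqrt q ^ k" for k
      by (rule cov_decay[OF \<open>0 < q\<close> assms(3,4)])
  qed (use fin sets assms(1) in simp_all)
  interpret L: finite_measure circle_lebesgue by (rule finite_circle_lebesgue)
  have "AE \<theta> in circle_lebesgue. ennreal (dens \<theta>) = RN_deriv circle_lebesgue \<nu> \<theta>"
    by (rule L.RN_deriv_unique[OF _ density_dens]) measurable
  then have "AE \<theta> in circle_lebesgue. RN_deriv circle_lebesgue \<nu> \<theta> = ennreal (dens \<theta>)"
    by (simp add: eq_commute)
  moreover have "absolutely_continuous circle_lebesgue \<nu>"
    by (subst density_dens[symmetric], rule absolutely_continuousI_density) measurable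
  ultimately show ?thesis using dens_analytic dens_nonneg by blast
qed

end
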